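(* For every cutting $P$ of the pizza (with any number $n\ge 1$ of slices and any nonnegative slice sizes), Alice has a two-jump strategy with gain $4|P|/9$.
   Context: The pizza game: a pizza is cut into $n\ge1$ slices forming a circular sequence $P=p_0p_1\dots p_{n-1}$ (indices modulo $n$, $p_i$ adjacent to $p_{i\pm1}$), each slice having a size $|p_i|\ge 0$; $|P|=\sum_i|p_i|$. Alice and Bob alternately take slices, one per turn, Alice first. In the first turn Alice may take any slice; in every later turn the player must take a slice that has a neighbor already taken (equivalently, the remaining slices always form a contiguous arc of the circle). For $1<j\le n$, if a player took $p_i$ in turn $j-1$ and the other player takes $p_{i-1}$ or $p_{i+1}$ in turn $j$, turn $j$ is a shift; otherwise it is a jump. A strategy of a player is a $j$-jump strategy if it makes at most $j$ jumps of that player. A strategy has gain $g$ if it guarantees the player a set of slices of total size at least $g$, whatever the opponent does. *)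

theory Defs
  imports Complex_Main
begin

text \<open>
  A pizza with \<open>n\<close> slices has the slices \<open>0, \<dots>, n - 1\<close> in circular order, and \<open>p i\<close> is the size
  of slice \<open>i\<close>.
\<close>

definition pizza :: "nat \<Rightarrow> (nat \<Rightarrow> real) \<Rightarrow> bool" where
  "pizza n p \<longleftrightarrow> n \<ge> 1 \<and> (\<forall>i<n. p i \<ge> 0)"

definition pizza_size :: "nat \<Rightarrow> (nat \<Rightarrow> real) \<Rightarrow> real" where
  "pizza_size n p = (\<Sum>i<n. p i)"

definition adjacent :: "nat \<Rightarrow> nat \<Rightarrow> nat \<Rightarrow> bool" where
  "adjacent n i j \<longleftrightarrow> j = (i + 1) mod n \<or> i = (j + 1) mod n"

text \<open>
  A history \<open>h\<close> lists the slices taken so far, in the order in which they were taken.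
  List positions count from 0, so \<open>h ! k\<close> is the slice taken in turn \<open>k + 1\<close>, and Alice moves
  exactly at the even positions.
\<close>

definition legal_move :: "nat \<Rightarrow> nat list \<Rightarrow> nat \<Rightarrow> bool" where
  "legal_move n h i \<longleftrightarrow> i < n \<and> i \<notin> set h \<and> (h = [] \<or> (\<exists>j\<in>set h. adjacent n j i))"

definition legal_history :: "nat \<Rightarrow> nat list \<Rightarrow> bool" where
  "legal_history n h \<longleftrightarrow> (\<forall>k<length h. legal_move n (take k h) (h ! k))"

definition jump :: "nat \<Rightarrow> nat list \<Rightarrow> nat \<Rightarrow> bool" where
  "jump n h k \<longleftrightarrow> 0 < k \<and> k < length h \<and> \<not> adjacent n (h ! (k - 1)) (h ! k)"

definition alice_jumps :: "nat \<Rightarrow> nat list \<Rightarrow> nat" where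
  "alice_jumps n h = card {k. even k \<and> jump n h k}"

definition alice_total :: "(nat \<Rightarrow> real) \<Rightarrow> nat list \<Rightarrow> real" where
  "alice_total p h = (\<Sum>k | k < length h \<and> even k. p (h ! k))"

text \<open>
  A strategy of Alice maps each history in which it is her turn to the slice she takes next;
  Bob's moves in a history that follows the strategy are arbitrary legal ones.
\<close>

definition follows :: "(nat list \<Rightarrow> nat) \<Rightarrow> nat list \<Rightarrow> bool" where
  "follows \<sigma> h \<longleftrightarrow> (\<forall>k<length h. even k \<longrightarrow> h ! k = \<sigma> (take k h))"

definition alice_strategy :: "nat \<Rightarrow> (nat list \<Rightarrow> nat) \<Rightarrow> bool" where
  "alice_strategy n \<sigma> \<longleftrightarrow>
    (\<forall>h. legal_history n h \<and> follows \<sigma> h \<and> even (length h) \<and> length h < n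
      \<longrightarrow> legal_move n h (\<sigma> h))"

definition complete_play :: "nat \<Rightarrow> (nat list \<Rightarrow> nat) \<Rightarrow> nat list \<Rightarrow> bool" where
  "complete_play n \<sigma> h \<longleftrightarrow> legal_history n h \<and> follows \<sigma> h \<and> length h = n"

definition jump_strategy :: "nat \<Rightarrow> nat \<Rightarrow> (nat list \<Rightarrow> nat) \<Rightarrow> bool" where
  "jump_strategy n j \<sigma> \<longleftrightarrow>
    alice_strategy n \<sigma> \<and> (\<forall>h. complete_play n \<sigma> h \<longrightarrow> alice_jumps n h \<le> j)"

definition has_gain :: "nat \<Rightarrow> (nat \<Rightarrow> real) \<Rightarrow> (nat list \<Rightarrow> nat) \<Rightarrow> real \<Rightarrow> bool" where
  "has_gain n p \<sigma> g \<longleftrightarrow> (\<forall>h. complete_play n \<sigma> h \<longrightarrow> alice_total p h \<ge> g)"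

end

(*
  If n is even, Alice takes the heavier colour class of the alternating colouring, by shifts only.

  Let n = 2m + 1 and list the slices as q_i = p_(2i), indices modulo n.  In this cyclic order the
  slices of either player form an arc as long as Alice shifts, and the two arcs are opposite to each
  other: Bob chooses the side on which they grow, and a jump of Alice exchanges the two arcs.  By
  shifts only, Alice obtains at least the lightest half-circle (m + 1 consecutive slices) through her
  first slice.  An irredundant cover by half-circles that are lightest through some slice covered by
  no other member has at most three members.  With one or two of them, one weighs at least |P|/2.
  With three, of weights h1, h2, h3, every half-circle meeting the overlap E of the last two weighs at
  least min(h2, h3).  The slices B covered only by the first are opposite to E and |B| - |E| =
  |P| - h2 - h3.  Starting in B or in E and ending on the arc through E, Alice gains
  min(h2, h3) + (|B| - |E|)/2 - |E|/4 with two jumps.  Since the three overlaps add up to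
  h1 + h2 + h3 - |P|, one of h1, h2, h3 and the three gains of this kind is at least 4|P|/9.
*)
theory Submission
  imports Defs
begin

section \<open>Integer indices for slices, and the legal moves from an arc\<close>

definition slice :: "nat \<Rightarrow> int \<Rightarrow> nat" where
  "slice n i = nat (i mod int n)"

lemma slice_less: "n > 0 \<Longrightarrow> slice n i < n"
  unfolding slice_def by (simp add: nat_less_iff)

lemma slice_eq_iff: "n > 0 \<Longrightarrow> slice n i = slice n j \<longleftrightarrow> i mod int n = j mod int n"
  unfolding slice_def by (simp add: eq_nat_nat_iff)

lemma slice_of_nat: "i < n \<Longrightarrow> slice n (int i) = i"
  unfolding slice_def by simp

lemma slice_neq:
  assumes "n > 0" "i < j" "j < i + int n"
  shows "slice n i \<noteq> slice n j"
proof
  assume "slice n i = slice n j"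
  then have "int n dvd j - i"
    using assms(1) by (simp add: slice_eq_iff mod_eq_dvd_iff) (metis dvd_minus_iff minus_diff_eq)
  then show False
    using assms zdvd_imp_le by fastforce
qed

lemma adjacent_slice_iff:
  assumes "n > 0"
  shows "adjacent n (slice n i) (slice n j) \<longleftrightarrow>
    slice n j = slice n (i + 1) \<or> slice n j = slice n (i - 1)"
proof -
  have suc: "(slice n x + 1) mod n = slice n (x + 1)" for x
  proof -
    have "int ((slice n x + 1) mod n) = (x mod int n + 1) mod int n"
      using assms by (simp add: slice_def zmod_int add.commute)
    also have "\<dots> = int (slice n (x + 1))"
      using assms by (simp add: slice_def mod_add_left_eq)
    finally show ?thesis by simp
  qed
  have "slice n i = slice n (j + 1) \<longleftrightarrow> slice n j = slice n (i - 1)"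
    using assms by (simp add: slice_eq_iff mod_eq_dvd_iff algebra_simps)
      (metis add_diff_eq dvd_minus_iff minus_diff_eq diff_diff_eq2)
  then show ?thesis
    unfolding adjacent_def suc by simp
qed

text \<open>An untaken neighbour of the arc lies just beyond one of its ends; as
  \<open>k < n\<close>, both of these slices are untaken. They coincide for
  \<open>k = n - 1\<close>.\<close>

lemma legal_move_arc_iff:
  assumes h: "set h = slice n ` {l..<l + int k}" and k: "0 < k" "k < n"
  shows "legal_move n h x \<longleftrightarrow> x = slice n (l - 1) \<or> x = slice n (l + int k)"
proof
  assume L: "legal_move n h x"
  have "h \<noteq> []" using h k by auto
  with L h obtain i where i: "l \<le> i" "i < l + int k" "adjacent n (slice n i) x" "x < n" "x \<notin> set h"
    unfolding legal_move_def by auto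
  have "x = slice n (int x)" using i by (simp add: slice_of_nat)
  then have "x = slice n (i + 1) \<or> x = slice n (i - 1)"
    using i(3) adjacent_slice_iff[of n i "int x"] k by auto
  then show "x = slice n (l - 1) \<or> x = slice n (l + int k)"
  proof
    assume x: "x = slice n (i + 1)"
    then have "\<not> i + 1 < l + int k" using i h by auto
    then have "i + 1 = l + int k" using i by simp
    with x show ?thesis by simp
  next
    assume x: "x = slice n (i - 1)"
    then have "\<not> l \<le> i - 1" using i h by auto
    then have "i - 1 = l - 1" using i by simp
    with x show ?thesis by simp
  qed
next
  assume "x = slice n (l - 1) \<or> x = slice n (l + int k)"
  then show "legal_move n h x"
  proof
    assume x: "x = slice n (l - 1)"
    have "x \<notin> set h" using k unfolding x h by (smt (verit) atLeastLessThan_iff imageE of_nat_less_iff slice_neq)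
    moreover have "adjacent n (slice n l) x" using k unfolding x by (simp add: adjacent_slice_iff)
    moreover have "slice n l \<in> set h" using k h by auto
    ultimately show ?thesis using k x slice_less[of n "l - 1"] unfolding legal_move_def by auto
  next
    assume x: "x = slice n (l + int k)"
    have "x \<notin> set h" using k slice_neq[of n _ "l + int k"] unfolding x h by fastforce
    moreover have "adjacent n (slice n (l + int k - 1)) x" using k unfolding x by (simp add: adjacent_slice_iff)
    moreover have "slice n (l + int k - 1) \<in> set h" using k h by auto
    ultimately show ?thesis using k x slice_less[of n "l + int k"] unfolding legal_move_def by auto
  qed
qed

section \<open>Histories, guaranteed values and the strategy built from them\<close>

lemma legal_history_snoc: "legal_history n (h @ [x]) \<longleftrightarrow> legal_history n h \<and> legal_move n h x"
  unfolding legal_history_def by (auto simp: less_Suc_eq nth_append)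

lemma follows_snoc:
  "follows \<sigma> (h @ [x]) \<longleftrightarrow> follows \<sigma> h \<and> (even (length h) \<longrightarrow> x = \<sigma> h)"
  unfolding follows_def by (auto simp: less_Suc_eq nth_append)

lemma alice_total_snoc:
  "alice_total p (h @ [x]) = alice_total p h + (if even (length h) then p x else 0)"
proof -
  have "{k. k < length (h @ [x]) \<and> even k} =
      {k. k < length h \<and> even k} \<union> (if even (length h) then {length h} else {})"
    by (auto simp: less_Suc_eq)
  moreover have "(\<Sum>k | k < length h \<and> even k. p ((h @ [x]) ! k)) = alice_total p h"
    unfolding alice_total_def by (intro sum.cong) (auto simp: nth_append)
  ultimately show ?thesis
    unfolding alice_total_def by (auto simp: sum.union_disjoint)
qed

lemma alice_jumps_snoc:
  assumes "h \<noteq> []"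
  shows "alice_jumps n (h @ [x]) =
    alice_jumps n h + (if even (length h) \<and> \<not> adjacent n (last h) x then 1 else 0)"
proof -
  have "{k. even k \<and> jump n (h @ [x]) k} = {k. even k \<and> jump n h k} \<union>
      (if even (length h) \<and> \<not> adjacent n (last h) x then {length h} else {})"
    using assms by (auto simp: jump_def less_Suc_eq nth_append last_conv_nth)
  moreover have "finite {k. even k \<and> jump n h k}"
    by (rule finite_subset[of _ "{..<length h}"]) (auto simp: jump_def)
  moreover have "length h \<notin> {k. even k \<and> jump n h k}"
    by (simp add: jump_def)
  ultimately show ?thesis
    unfolding alice_jumps_def by auto
qed

text \<open>
  \<open>guarantees P n d J l g\<close>: Alice has just moved, the slices still on the plate are
  \<open>l - d, \<dots>, l - 1\<close> modulo \<open>n\<close>, and she can collect another \<open>g\<close> with at most \<open>J\<close> jumps.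
\<close>

fun guarantees :: "(int \<Rightarrow> real) \<Rightarrow> nat \<Rightarrow> nat \<Rightarrow> nat \<Rightarrow> int \<Rightarrow> real \<Rightarrow> bool" where
  "guarantees P n 0 J l g \<longleftrightarrow> g \<le> 0"
| "guarantees P n (Suc 0) J l g \<longleftrightarrow> g \<le> 0"
| "guarantees P n (Suc (Suc d)) J l g \<longleftrightarrow>
    (guarantees P n d J (l - 2) (g - P (l - 2)) \<or>
      (\<exists>J'. J = Suc J' \<and> guarantees P n d J' (l - 1) (g - P (l + int n - int d - 2)))) \<and>
    (guarantees P n d J l (g - P (l + int n - int d - 1)) \<or>
      (\<exists>J'. J = Suc J' \<and> guarantees P n d J' (l - 1) (g - P (l - 1))))"

text \<open>The invariant after each move of Alice. As \<open>l\<close> and \<open>J'\<close> are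
  quantified away, it depends on the history alone, so a strategy can be chosen from it.\<close>

definition good_position :: "nat \<Rightarrow> (nat \<Rightarrow> real) \<Rightarrow> nat \<Rightarrow> real \<Rightarrow> nat list \<Rightarrow> bool" where
  "good_position n p J G h \<longleftrightarrow> odd (length h) \<and> length h \<le> n \<and>
    (\<exists>l J'. set h = slice n ` {l..<l + int (length h)} \<and>
      guarantees (\<lambda>i. p (slice n i)) n (n - length h) J' l (G - alice_total p h) \<and>
      alice_jumps n h + J' \<le> J)"

lemma insert_image_arc:
  "insert (f (l - 1)) (f ` {l..<r}) = f ` {l - 1..<r}"
  "insert (f r) (f ` {l..<r}) = f ` {l..<r + 1}" if "l \<le> r" for l r :: int
proof -
  have "{l - 1..<r} = insert (l - 1) {l..<r}" "{l..<r + 1} = insert r {l..<r}"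
    using that by auto
  then show "insert (f (l - 1)) (f ` {l..<r}) = f ` {l - 1..<r}"
    "insert (f r) (f ` {l..<r}) = f ` {l..<r + 1}" by simp_all
qed

lemma good_position_step:
  assumes good: "good_position n p J G h" and j: "legal_move n h j" and len: "length h + 1 < n"
  shows "\<exists>i. legal_move n (h @ [j]) i \<and> good_position n p J G (h @ [j, i])"
proof -
  define k where "k = length h"
  define P where "P = (\<lambda>i. p (slice n i))"
  obtain d where d: "n - k = Suc (Suc d)"
    using len unfolding k_def by (metis Suc_diff_Suc add.commute add_lessD1 plus_1_eq_Suc)
  \<comment> \<open>Hence \<open>l + int n - int d - 2\<close> in \<open>guarantees\<close> is
    \<open>l + int k\<close>, the slice just right of the taken arc.\<close>
  have nk: "int n - int d - 2 = int k" using d by linarith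
  from good obtain l J' where odd: "odd k" and h: "set h = slice n ` {l..<l + int k}"
    and g: "guarantees P n (Suc (Suc d)) J' l (G - alice_total p h)"
    and jumps: "alice_jumps n h + J' \<le> J"
    unfolding good_position_def k_def[symmetric] d P_def by blast
  have k0: "0 < k" "k < n" "k + 1 < n" using odd len by (auto simp: k_def odd_pos)
  have hne: "h \<noteq> []" using k0 k_def by auto
  have n0: "n > 0" using k0 by simp
  \<comment> \<open>A reply charged as a jump need not be one: the last slice of all is adjacent to
    Bob's. Overcounting jumps is harmless.\<close>
  have key: "\<exists>i. legal_move n (h @ [j]) i \<and> good_position n p J G (h @ [j, i])"
    if i: "legal_move n (h @ [j]) (slice n i)"
      and s: "insert (slice n i) (insert j (set h)) = slice n ` {l'..<l' + int k + 2}"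
      and g': "guarantees P n d J'' l' (G - alice_total p h - P i)"
      and J'': "adjacent n j (slice n i) \<and> J'' = J' \<or> Suc J'' = J'" for i l' J''
  proof -
    have "alice_total p (h @ [j, slice n i]) = alice_total p h + P i"
      using alice_total_snoc[of p "h @ [j]" "slice n i"] alice_total_snoc[of p h j] odd
      by (simp add: P_def k_def)
    moreover have "alice_jumps n (h @ [j, slice n i]) + J'' \<le> J"
      using alice_jumps_snoc[of "h @ [j]" n "slice n i"] alice_jumps_snoc[of h n j] odd hne jumps J''
      by (auto simp: k_def)
    moreover have "set (h @ [j, slice n i]) = slice n ` {l'..<l' + int (length (h @ [j, slice n i]))}"
      using s by (simp add: k_def insert_commute algebra_simps)
    moreover have "n - length (h @ [j, slice n i]) = d" using d k_def by simp
    ultimately have "good_position n p J G (h @ [j, slice n i])"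
      using g' odd k0 unfolding good_position_def P_def
      by (auto simp: k_def diff_diff_eq[symmetric] intro!: exI[of _ l'] exI[of _ J''])
    with i show ?thesis by blast
  qed
  have "j = slice n (l - 1) \<or> j = slice n (l + int k)"
    using j legal_move_arc_iff[OF h k0(1,2)] by simp
  then show ?thesis
  proof
    assume jl: "j = slice n (l - 1)"
    have s: "set (h @ [j]) = slice n ` {l - 1..<l - 1 + int (k + 1)}"
      using h jl k0 insert_image_arc(1)[of l "l + int k" "slice n"] by simp
    note leg = legal_move_arc_iff[OF s, unfolded of_nat_add of_nat_1]
    from g nk have "guarantees P n d J' (l - 2) (G - alice_total p h - P (l - 2)) \<or>
      (\<exists>J''. J' = Suc J'' \<and> guarantees P n d J'' (l - 1) (G - alice_total p h - P (l + int k)))"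
      by (simp add: algebra_simps)
    then show ?thesis
    proof (elim disjE exE conjE)
      assume "guarantees P n d J' (l - 2) (G - alice_total p h - P (l - 2))"
      moreover have "legal_move n (h @ [j]) (slice n (l - 2))" using leg k0 by simp
      moreover have "adjacent n j (slice n (l - 2))"
        using jl n0 by (simp add: adjacent_slice_iff)
      moreover have "insert (slice n (l - 2)) (insert j (set h)) = slice n ` {l - 2..<l - 2 + int k + 2}"
        using s insert_image_arc(1)[of "l - 1" "l + int k" "slice n"] by simp
      ultimately show ?thesis using key by blast
    next
      fix J'' assume "J' = Suc J''" "guarantees P n d J'' (l - 1) (G - alice_total p h - P (l + int k))"
      moreover have "legal_move n (h @ [j]) (slice n (l + int k))" using leg k0 by simp
      moreover have "insert (slice n (l + int k)) (insert j (set h)) = slice n ` {l - 1..<l - 1 + int k + 2}"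
        using s insert_image_arc(2)[of "l - 1" "l + int k" "slice n"] by (simp add: algebra_simps)
      ultimately show ?thesis using key by blast
    qed
  next
    assume jr: "j = slice n (l + int k)"
    have s: "set (h @ [j]) = slice n ` {l..<l + int (k + 1)}"
      using h jr k0 insert_image_arc(2)[of l "l + int k" "slice n"] by (simp add: algebra_simps)
    note leg = legal_move_arc_iff[OF s, unfolded of_nat_add of_nat_1]
    from g nk have "guarantees P n d J' l (G - alice_total p h - P (l + int k + 1)) \<or>
      (\<exists>J''. J' = Suc J'' \<and> guarantees P n d J'' (l - 1) (G - alice_total p h - P (l - 1)))"
      by (simp add: algebra_simps)
    then show ?thesis
    proof (elim disjE exE conjE)
      assume "guarantees P n d J' l (G - alice_total p h - P (l + int k + 1))"
      moreover have "legal_move n (h @ [j]) (slice n (l + int k + 1))" using leg k0 by (simp add: add.assoc)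
      moreover have "adjacent n j (slice n (l + int k + 1))"
        using jr n0 by (simp add: adjacent_slice_iff)
      moreover have "insert (slice n (l + int k + 1)) (insert j (set h)) = slice n ` {l..<l + int k + 2}"
        using s insert_image_arc(2)[of "l" "l + int k + 1" "slice n"] by (simp add: algebra_simps)
      ultimately show ?thesis using key by blast
    next
      fix J'' assume "J' = Suc J''" "guarantees P n d J'' (l - 1) (G - alice_total p h - P (l - 1))"
      moreover have "legal_move n (h @ [j]) (slice n (l - 1))" using leg k0 by simp
      moreover have "insert (slice n (l - 1)) (insert j (set h)) = slice n ` {l - 1..<l - 1 + int k + 2}"
        using s insert_image_arc(1)[of "l" "l + int k + 1" "slice n"] by (simp add: algebra_simps)
      ultimately show ?thesis using key by blast
    qed
  qed
qed

lemma good_position_start: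
  assumes "n > 0" and g: "guarantees (\<lambda>i. p (slice n i)) n (n - 1) J l (G - p (slice n l))"
  shows "good_position n p J G [slice n l]"
proof -
  have "{k. k < Suc 0 \<and> even k} = {0}" by auto
  then have "alice_total p [slice n l] = p (slice n l)"
    unfolding alice_total_def by simp
  moreover have "alice_jumps n [slice n l] = 0"
    unfolding alice_jumps_def jump_def by (intro card_eq_0_iff[THEN iffD2]) auto
  moreover have "{l..<l + 1} = {l}" by auto
  ultimately show ?thesis
    using assms unfolding good_position_def by (auto intro!: exI[of _ l] exI[of _ J])
qed

lemma good_position_final:
  assumes good: "good_position n p J G h" and len: "n - length h \<le> 1"
  shows "alice_total p h \<ge> G" "alice_jumps n h \<le> J"
proof -
  obtain l J' where g: "guarantees (\<lambda>i. p (slice n i)) n (n - length h) J' l (G - alice_total p h)"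
    and "alice_jumps n h + J' \<le> J"
    using good unfolding good_position_def by blast
  then show "alice_jumps n h \<le> J" by simp
  have "n - length h = 0 \<or> n - length h = Suc 0" using len by linarith
  then show "alice_total p h \<ge> G" using g by (elim disjE) simp_all
qed

text \<open>Alice picks any reply that preserves \<open>good_position\<close>. For odd
  \<open>n\<close> her last move ends the game; for even \<open>n\<close> Bob's final move changes
  neither her total nor her jumps.\<close>

lemma strategy_of_guarantees:
  assumes "n > 0" and g: "guarantees (\<lambda>i. p (slice n i)) n (n - 1) J l (G - p (slice n l))"
  shows "\<exists>\<sigma>. jump_strategy n J \<sigma> \<and> has_gain n p \<sigma> G"
proof -
  define \<sigma> where "\<sigma> h = (if h = [] then slice n l
      else SOME i. legal_move n h i \<and> good_position n p J G (h @ [i]))" for h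
  have move: "legal_move n (h @ [j]) (\<sigma> (h @ [j])) \<and> good_position n p J G ((h @ [j]) @ [\<sigma> (h @ [j])])"
    if "good_position n p J G h" "legal_move n h j" "length h + 1 < n" for h j
    using someI_ex[OF good_position_step[OF that]] unfolding \<sigma>_def by simp
  have start: "good_position n p J G [\<sigma> []]"
    using good_position_start[OF assms] unfolding \<sigma>_def by simp
  have good: "good_position n p J G h"
    if "legal_history n h" "follows \<sigma> h" "odd (length h)" "length h \<le> n" for h
    using that
  proof (induction "length h" arbitrary: h rule: less_induct)
    case less
    obtain h1 i where h: "h = h1 @ [i]" using less.prems(3) by (cases h rule: rev_cases) auto
    show ?case
    proof (cases h1 rule: rev_cases)
      case Nil
      then show ?thesis using less.prems start h by (simp add: follows_def)
    next
      case (snoc h2 j)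
      have L: "legal_history n h2" "legal_move n h2 j"
        using less.prems(1) legal_history_snoc[of n "h2 @ [j]" i] legal_history_snoc[of n h2 j]
        unfolding h snoc by simp_all
      have F: "follows \<sigma> h2" "i = \<sigma> (h2 @ [j])"
        using less.prems(2,3) follows_snoc[of \<sigma> "h2 @ [j]" i] follows_snoc[of \<sigma> h2 j] unfolding h snoc by auto
      have "good_position n p J G h2"
        using less.hyps[of h2] less.prems L F unfolding h snoc by simp
      then show ?thesis
        using move[of h2 j] L F less.prems(4) unfolding h snoc by simp
    qed
  qed
  have "alice_strategy n \<sigma>"
    unfolding alice_strategy_def
  proof (intro allI impI)
    fix h assume h: "legal_history n h \<and> follows \<sigma> h \<and> even (length h) \<and> length h < n"
    show "legal_move n h (\<sigma> h)"
    proof (cases h rule: rev_cases)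
      case Nil
      then show ?thesis using \<open>n > 0\<close> by (simp add: legal_move_def \<sigma>_def slice_less)
    next
      case (snoc h1 j)
      then have "good_position n p J G h1" "legal_move n h1 j" "length h1 + 1 < n"
        using h good[of h1] by (auto simp: legal_history_snoc follows_snoc)
      then show ?thesis using move snoc by blast
    qed
  qed
  moreover have "alice_jumps n h \<le> J \<and> alice_total p h \<ge> G" if h: "complete_play n \<sigma> h" for h
  proof (cases "odd n")
    case True
    then have "good_position n p J G h" using h good unfolding complete_play_def by simp
    then show ?thesis using good_position_final[of n p J G h] h unfolding complete_play_def by simp
  next
    case False
    obtain h1 j where hj: "h = h1 @ [j]"
      using h \<open>n > 0\<close> by (cases h rule: rev_cases) (auto simp: complete_play_def)
    then have g1: "good_position n p J G h1" "length h1 + 1 = n"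
      using h good[of h1] False unfolding complete_play_def
      by (auto simp: legal_history_snoc follows_snoc)
    then have "odd (length h1)" "h1 \<noteq> []" using False by auto
    then have "alice_total p h = alice_total p h1" "alice_jumps n h = alice_jumps n h1"
      unfolding hj using alice_jumps_snoc[of h1 n j] by (auto simp: alice_total_snoc)
    then show ?thesis using good_position_final[OF g1(1)] g1(2) by auto
  qed
  ultimately show ?thesis
    unfolding jump_strategy_def has_gain_def by blast
qed

lemma guarantees_antimono:
  "guarantees P n d J l g \<Longrightarrow> g' \<le> g \<Longrightarrow> guarantees P n d J l g'"
proof (induction d arbitrary: J l g g' rule: induct_nat_012)
  case (ge2 d)
  have "guarantees P n d J' l' (g' - c)" if "guarantees P n d J' l' (g - c)" for J' l' c
    using ge2.IH(1)[OF that] ge2.prems(2) by simp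
  then show ?case
    using ge2.prems(1) unfolding guarantees.simps by blast
qed simp_all

lemma guarantees_periodic:
  assumes "\<And>i. P (i + int n) = P i"
  shows "guarantees P n d J (l + int n) g \<longleftrightarrow> guarantees P n d J l g"
proof (induction d arbitrary: J l g rule: induct_nat_012)
  case (ge2 d)
  have s: "P (l + int n - 2) = P (l - 2)" "P (l + int n - 1) = P (l - 1)"
    "P (l + int n + int n - int d - 2) = P (l + int n - int d - 2)"
    "P (l + int n + int n - int d - 1) = P (l + int n - int d - 1)"
    using assms[of "l - 2"] assms[of "l - 1"] assms[of "l + int n - int d - 2"]
      assms[of "l + int n - int d - 1"] by (simp_all add: algebra_simps)
  have t: "guarantees P n d J' (l + int n - 2) g' \<longleftrightarrow> guarantees P n d J' (l - 2) g'"
    "guarantees P n d J' (l + int n - 1) g' \<longleftrightarrow> guarantees P n d J' (l - 1) g'" for J' g'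
    using ge2.IH(1)[of J' "l - 2" g'] ge2.IH(1)[of J' "l - 1" g'] by (simp_all add: algebra_simps)
  show ?case
    unfolding guarantees.simps s t ge2.IH(1) ..
qed simp_all

section \<open>Odd pizzas: the game in the order of steps of two\<close>

locale odd_pizza =
  fixes P :: "int \<Rightarrow> real" and m :: nat and F :: "int \<Rightarrow> real"
  assumes P_nonneg: "P i \<ge> 0"
    and P_periodic: "P (i + (2 * int m + 1)) = P i"
    and F_step: "F (i + 1) = F i + P (2 * i)"
begin

abbreviation n :: nat where "n \<equiv> 2 * m + 1"

text \<open>
  \<open>q\<close> lists the slices in steps of two, and \<open>F\<close> is an antiderivative of \<open>q\<close>, so that the slices at
  \<open>i, \<dots>, j - 1\<close> of this order weigh \<open>F j - F i\<close>.  In \<open>reach J s k g\<close> Alice has just moved, her arc is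
  \<open>s, \<dots>, s + k\<close>, Bob's is \<open>s + m + 1, \<dots>, s + m + k\<close>, and she can collect another \<open>g\<close> with at most
  \<open>J\<close> jumps.
\<close>

definition q :: "int \<Rightarrow> real" where "q i = P (2 * i)"

definition half :: "int \<Rightarrow> real" where "half u = F (u + int m + 1) - F u"

definition reach :: "nat \<Rightarrow> int \<Rightarrow> nat \<Rightarrow> real \<Rightarrow> bool" where
  "reach J s k g \<longleftrightarrow> guarantees P n (2 * (m - k)) J (2 * s) g"

definition whole :: real where "whole = F (int n) - F 0"

lemma F_q: "F (i + 1) = F i + q i"
  by (simp add: F_step q_def)

lemma q_nonneg: "q i \<ge> 0"
  by (simp add: q_def P_nonneg)

lemma P_periodic': "P (i + int n) = P i"
  using P_periodic[of i] by (simp add: algebra_simps)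

lemma q_periodic: "q (i + int n) = q i"
  using P_periodic'[of "2 * i"] P_periodic'[of "2 * i + int n"]
  by (simp add: q_def algebra_simps)

lemma F_mono: "i \<le> j \<Longrightarrow> F i \<le> F j"
proof (induction rule: int_ge_induct)
  case (step j)
  then show ?case using F_q[of j] q_nonneg[of j] by simp
qed simp

lemma F_periodic: "F (i + int n) = F i + whole"
proof (induction i rule: int_induct[where k = 0])
  case (step1 i)
  then show ?case using F_q[of i] F_q[of "i + int n"] q_periodic[of i] by (simp add: algebra_simps)
next
  case (step2 i)
  then show ?case using F_q[of "i - 1"] F_q[of "i - 1 + int n"] q_periodic[of "i - 1"]
    by (simp add: algebra_simps)
qed (simp add: whole_def)

lemma half_periodic: "half (u + int n) = half u"
  using F_periodic[of u] F_periodic[of "u + int m + 1"] by (simp add: half_def algebra_simps)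

lemma reach_antimono: "reach J s k g \<Longrightarrow> g' \<le> g \<Longrightarrow> reach J s k g'"
  unfolding reach_def by (rule guarantees_antimono)

lemma reach_periodic: "reach J (s + int n) k g \<longleftrightarrow> reach J s k g"
  using guarantees_periodic[of P n, OF P_periodic', of "2 * (m - k)" J "2 * s + int n" g]
    guarantees_periodic[of P n, OF P_periodic', of "2 * (m - k)" J "2 * s" g]
  by (simp add: reach_def algebra_simps)

lemma reach_final: "g \<le> 0 \<Longrightarrow> reach J s m g"
  by (simp add: reach_def)

text \<open>In \<open>L\<close> Bob has taken \<open>q (s + int m)\<close>, in \<open>R\<close>
  \<open>q (s + int m + int k + 1)\<close>; Alice shifts or takes the other end of Bob's arc. After
  a jump the arc from \<open>s + int m\<close> is the one she extends, whoever owns its slices: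
  \<open>reach\<close> concerns only what is still to be collected.\<close>

lemma reach_step:
  assumes k: "k < m"
    and L: "reach J (s - 1) (Suc k) (g - q (s - 1)) \<or>
      (\<exists>J'. J = Suc J' \<and> reach J' (s + int m) (Suc k) (g - q (s + int m + int k + 1)))"
    and R: "reach J s (Suc k) (g - q (s + int k + 1)) \<or>
      (\<exists>J'. J = Suc J' \<and> reach J' (s + int m) (Suc k) (g - q (s + int m)))"
  shows "reach J s k g"
proof -
  define d where "d = 2 * (m - Suc k)"
  have d: "2 * (m - k) = Suc (Suc d)" "int d = 2 * int m - 2 * int k - 2"
    using k by (auto simp: d_def)
  \<comment> \<open>A jump moves \<open>l = 2 * s\<close> to \<open>2 * s - 1\<close>, which is
    \<open>2 * (s + int m)\<close> up to one turn around the circle.\<close>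
  have jump: "guarantees P n d J' (2 * s - 1) g' \<longleftrightarrow> reach J' (s + int m) (Suc k) g'" for J' g'
    using guarantees_periodic[of P n, OF P_periodic', of d J' "2 * s - 1" g']
    by (simp add: reach_def d_def algebra_simps)
  have shift: "guarantees P n d J (2 * s - 2) g' \<longleftrightarrow> reach J (s - 1) (Suc k) g'"
    "guarantees P n d J (2 * s) g' \<longleftrightarrow> reach J s (Suc k) g'" for g'
    by (simp_all add: reach_def d_def algebra_simps)
  have q: "q (s - 1) = P (2 * s - 2)" "q (s + int k + 1) = P (2 * s + int n - int d - 1)"
    "q (s + int m) = P (2 * s - 1)" "q (s + int m + int k + 1) = P (2 * s + int n - int d - 2)"
    using P_periodic'[of "2 * s - 1"] P_periodic'[of "2 * s + int n - int d - 2"]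
    by (simp_all add: q_def d algebra_simps)
  show ?thesis
    using L R unfolding reach_def[of J s k] d guarantees.simps jump shift q by blast
qed

text \<open>Shifts extend the arc \<open>s, ..., s + k\<close> to a half-circle
  \<open>u, ..., u + m\<close> containing it, Bob choosing \<open>u\<close>; the weight of the
  present arc is already taken.\<close>

lemma reach_by_shifts:
  assumes "k \<le> m"
    and "\<And>u. s + int k - int m \<le> u \<Longrightarrow> u \<le> s \<Longrightarrow> g \<le> half u - (F (s + int k + 1) - F s)"
  shows "reach J s k g"
  using assms
proof (induction "m - k" arbitrary: s k g)
  case 0
  then have "k = m" by simp
  then show ?case using "0.prems"(2)[of s] by (simp add: reach_final half_def)
next
  case (Suc d)
  then have k: "k < m" by simp
  have "reach J (s - 1) (Suc k) (g - q (s - 1))"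
  proof (rule Suc.hyps(1))
    show "g - q (s - 1) \<le> half u - (F (s - 1 + int (Suc k) + 1) - F (s - 1))"
      if "s - 1 + int (Suc k) - int m \<le> u" "u \<le> s - 1" for u
      using Suc.prems(2)[of u] that F_q[of "s - 1"] by (simp add: algebra_simps)
  qed (use Suc.hyps k in auto)
  moreover have "reach J s (Suc k) (g - q (s + int k + 1))"
  proof (rule Suc.hyps(1))
    show "g - q (s + int k + 1) \<le> half u - (F (s + int (Suc k) + 1) - F s)"
      if "s + int (Suc k) - int m \<le> u" "u \<le> s" for u
      using Suc.prems(2)[of u] that F_q[of "s + int k + 1"] by (simp add: algebra_simps)
  qed (use Suc.hyps k in auto)
  ultimately show ?case using reach_step[OF k] by blast
qed

text \<open>
  If Alice owns the slices \<open>\<beta>, \<dots>, x - 1\<close> and Bob the opposite ones \<open>\<beta> + m, \<dots>, x + m - 1\<close>, then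
  \<open>G x - G \<beta>\<close> is her lead; if she owns \<open>x, \<dots>, y - 1\<close> and Bob \<open>x + m + 1, \<dots>, y + m\<close>, it is \<open>L y - L x\<close>.
\<close>

definition G :: "int \<Rightarrow> real" where "G x = F x - F (x + int m)"

definition L :: "int \<Rightarrow> real" where "L x = F x - F (x + int m + 1)"

lemma L_G: "L x = G x - q (x + int m)"
  using F_q[of "x + int m"] by (simp add: L_def G_def)

text \<open>
  Alice starts in \<open>\<beta>, \<dots>, \<beta> + b - 1\<close> and jumps when Bob's move would make her shift leave that arc.
  Her lead at this moment is bounded by \<open>left\<close> or \<open>right\<close>, according to the end that was reached.
\<close>

lemma reach_one_jump:
  fixes \<beta> :: int and b :: nat
  assumes b: "b \<le> m"
    and \<mu>: "\<And>u. \<beta> \<le> u \<Longrightarrow> u \<le> \<beta> + int m + int b \<Longrightarrow> \<mu> \<le> half u"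
    and s: "\<beta> \<le> s" "s + int k < \<beta> + int b"
    and left: "\<And>x. s + int k < x \<Longrightarrow> x \<le> \<beta> + int b \<Longrightarrow> \<gamma> \<le> \<mu> + G x - G \<beta>"
    and right: "\<And>x. \<beta> \<le> x \<Longrightarrow> x \<le> s \<Longrightarrow> \<gamma> \<le> \<mu> + L (\<beta> + int b) - L x"
  shows "reach (Suc J) s k (\<gamma> - (F (s + int k + 1) - F s))"
  using s left right
proof (induction "m - k" arbitrary: s k)
  \<comment> \<open>Void: the arc has \<open>k + 1 \<le> b \<le> m\<close> slices, so the jump comes
    before the pizza is finished.\<close>
  case 0
  then show ?case using b by simp
next
  case (Suc d)
  then have k: "k < m" by simp
  \<comment> \<open>After the jump only shifts follow, so the arc ends as a half-circle of weight at
    least \<open>\<mu>\<close>; its slices taken so far, her new one included, are deducted.\<close>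
  have jump: "reach J (s + int m) (Suc k) (\<mu> - (F (s + int m + int k + 2) - F (s + int m)))"
  proof (rule reach_by_shifts)
    show "\<mu> - (F (s + int m + int k + 2) - F (s + int m))
        \<le> half u - (F (s + int m + int (Suc k) + 1) - F (s + int m))"
      if "s + int m + int (Suc k) - int m \<le> u" "u \<le> s + int m" for u
      using \<mu>[of u] that Suc.prems by (simp add: algebra_simps)
  qed (use k in simp)
  show ?case
  proof (rule reach_step[OF k])
    show "reach (Suc J) (s - 1) (Suc k) (\<gamma> - (F (s + int k + 1) - F s) - q (s - 1)) \<or>
      (\<exists>J'. Suc J = Suc J' \<and> reach J' (s + int m) (Suc k)
        (\<gamma> - (F (s + int k + 1) - F s) - q (s + int m + int k + 1)))"
    proof (cases "s = \<beta>")
      case True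
      have "\<gamma> \<le> \<mu> + G (s + int k + 1) - G \<beta>" using Suc.prems by simp
      then have "\<gamma> - (F (s + int k + 1) - F s) - q (s + int m + int k + 1)
          \<le> \<mu> - (F (s + int m + int k + 2) - F (s + int m))"
        using True F_q[of "s + int m + int k + 1"] by (simp add: G_def algebra_simps)
      then show ?thesis using reach_antimono[OF jump] by blast
    next
      case False
      have "reach (Suc J) (s - 1) (Suc k) (\<gamma> - (F (s - 1 + int (Suc k) + 1) - F (s - 1)))"
        by (rule Suc.hyps(1)) (use Suc.hyps Suc.prems False in auto)
      then show ?thesis using F_q[of "s - 1"] by (simp add: algebra_simps)
    qed
    show "reach (Suc J) s (Suc k) (\<gamma> - (F (s + int k + 1) - F s) - q (s + int k + 1)) \<or>
      (\<exists>J'. Suc J = Suc J' \<and> reach J' (s + int m) (Suc k)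
        (\<gamma> - (F (s + int k + 1) - F s) - q (s + int m)))"
    proof (cases "s + int k + 1 = \<beta> + int b")
      case True
      have "\<gamma> \<le> \<mu> + L (s + int k + 1) - L s" using Suc.prems True by simp
      then have "\<gamma> - (F (s + int k + 1) - F s) - q (s + int m)
          \<le> \<mu> - (F (s + int m + int k + 2) - F (s + int m))"
        using F_q[of "s + int m"] by (simp add: L_def algebra_simps)
      then show ?thesis using reach_antimono[OF jump] by blast
    next
      case False
      have "reach (Suc J) s (Suc k) (\<gamma> - (F (s + int (Suc k) + 1) - F s))"
        by (rule Suc.hyps(1)) (use Suc.hyps Suc.prems False in auto)
      then show ?thesis using F_q[of "s + int k + 1"] by (simp add: algebra_simps)
    qed
  qed
qed

text \<open>
  Alice starts opposite to \<open>w\<close>, jumps when Bob takes \<open>\<sigma>\<close> or \<open>\<tau> - 1\<close>, and goes on as in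
  \<open>reach_one_jump\<close>.  In \<open>LL\<close>, \<open>LR\<close>, \<open>RL\<close>, \<open>RR\<close> the letters are the ends reached before the first and
  before the second jump.
\<close>

lemma reach_two_jumps:
  fixes \<beta> :: int and b :: nat
  assumes b: "b \<le> m"
    and \<mu>: "\<And>u. \<beta> \<le> u \<Longrightarrow> u \<le> \<beta> + int m + int b \<Longrightarrow> \<mu> \<le> half u"
    and \<sigma>\<tau>: "\<beta> \<le> \<sigma>" "\<tau> \<le> \<beta> + int b"
    and x: "\<sigma> < x" "x \<le> w" "w \<le> x + int k" "x + int k < \<tau>"
    and LL: "\<And>t y. w \<le> t \<Longrightarrow> t < \<tau> \<Longrightarrow> t < y \<Longrightarrow> y \<le> \<beta> + int b \<Longrightarrow>
      \<gamma> + L t - L \<sigma> \<le> \<mu> + G y - G \<beta>"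
    and LR: "\<And>t y. w \<le> t \<Longrightarrow> t < \<tau> \<Longrightarrow> \<beta> \<le> y \<Longrightarrow> y \<le> \<sigma> \<Longrightarrow>
      \<gamma> + L t - L \<sigma> \<le> \<mu> + L (\<beta> + int b) - L y"
    and RL: "\<And>t y. \<sigma> < t \<Longrightarrow> t \<le> w \<Longrightarrow> \<tau> \<le> y \<Longrightarrow> y \<le> \<beta> + int b \<Longrightarrow>
      \<gamma> + G \<tau> - G t \<le> \<mu> + G y - G \<beta>"
    and RR: "\<And>t y. \<sigma> < t \<Longrightarrow> t \<le> w \<Longrightarrow> \<beta> \<le> y \<Longrightarrow> y < t \<Longrightarrow>
      \<gamma> + G \<tau> - G t \<le> \<mu> + L (\<beta> + int b) - L y"
  shows "reach (Suc (Suc J)) (x + int m) k (\<gamma> - (F (x + int m + int k + 1) - F (x + int m)))"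
  using x
proof (induction "m - k" arbitrary: x k)
  case 0
  then show ?case using b \<sigma>\<tau> by simp
next
  case (Suc d)
  then have k: "k < m" by simp
  have shift: "x + int m + int m = x - 1 + int n" by simp
  show ?case
  proof (rule reach_step[OF k])
    show "reach (Suc (Suc J)) (x + int m - 1) (Suc k)
        (\<gamma> - (F (x + int m + int k + 1) - F (x + int m)) - q (x + int m - 1)) \<or>
      (\<exists>J'. Suc (Suc J) = Suc J' \<and> reach J' (x + int m + int m) (Suc k)
        (\<gamma> - (F (x + int m + int k + 1) - F (x + int m)) - q (x + int m + int m + int k + 1)))"
    proof (cases "x = \<sigma> + 1")
      case True
      \<comment> \<open>With \<open>t = x + k\<close>, Alice owns
        \<open>\<sigma> + m + 1, ..., t + m\<close> and Bob \<open>\<sigma>, ..., t - 1\<close>. Her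
        lead \<open>L \<sigma> - L t\<close> is taken off the target, so that
        \<open>reach_one_jump\<close> may count the new arc as hers. At the other end the lead is
        \<open>G x - G \<tau>\<close>.\<close>
      have "reach (Suc J) \<sigma> (Suc k)
          (\<gamma> + L (x + int k) - L \<sigma> - (F (\<sigma> + int (Suc k) + 1) - F \<sigma>))"
        by (rule reach_one_jump[where \<beta> = \<beta> and \<mu> = \<mu>, OF b \<mu>])
          (use Suc.prems \<sigma>\<tau> True LL[of "x + int k"] LR[of "x + int k"] in auto)
      moreover have "q (x + int m + int m + int k + 1) = q (x + int k)"
        using q_periodic[of "x + int k"] by (simp add: algebra_simps)
      ultimately have "reach (Suc J) (x + int m + int m) (Suc k)
        (\<gamma> - (F (x + int m + int k + 1) - F (x + int m)) - q (x + int m + int m + int k + 1))"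
        unfolding shift reach_periodic using True F_q[of "x + int k"] by (simp add: L_def algebra_simps)
      then show ?thesis by blast
    next
      case False
      have "reach (Suc (Suc J)) (x - 1 + int m) (Suc k)
          (\<gamma> - (F (x - 1 + int m + int (Suc k) + 1) - F (x - 1 + int m)))"
        by (rule Suc.hyps(1)) (use Suc.hyps Suc.prems False in auto)
      then show ?thesis using F_q[of "x + int m - 1"] by (simp add: algebra_simps)
    qed
    show "reach (Suc (Suc J)) (x + int m) (Suc k)
        (\<gamma> - (F (x + int m + int k + 1) - F (x + int m)) - q (x + int m + int k + 1)) \<or>
      (\<exists>J'. Suc (Suc J) = Suc J' \<and> reach J' (x + int m + int m) (Suc k)
        (\<gamma> - (F (x + int m + int k + 1) - F (x + int m)) - q (x + int m + int m)))"
    proof (cases "x + int k + 1 = \<tau>")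
      case True
      have "reach (Suc J) (x - 1) (Suc k)
          (\<gamma> + G \<tau> - G x - (F (x - 1 + int (Suc k) + 1) - F (x - 1)))"
        by (rule reach_one_jump[where \<beta> = \<beta> and \<mu> = \<mu>, OF b \<mu>])
          (use Suc.prems \<sigma>\<tau> True RL[of x] RR[of x] in auto)
      moreover have "q (x + int m + int m) = q (x - 1)"
        using q_periodic[of "x - 1"] by (simp add: algebra_simps)
      ultimately have "reach (Suc J) (x + int m + int m) (Suc k)
        (\<gamma> - (F (x + int m + int k + 1) - F (x + int m)) - q (x + int m + int m))"
        unfolding shift reach_periodic using True[symmetric] F_q[of "x - 1"]
        by (simp add: G_def algebra_simps)
      then show ?thesis by blast
    next
      case False
      have "reach (Suc (Suc J)) (x + int m) (Suc k)
          (\<gamma> - (F (x + int m + int (Suc k) + 1) - F (x + int m)))"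
        by (rule Suc.hyps(1)) (use Suc.hyps Suc.prems False in auto)
      then show ?thesis using F_q[of "x + int m + int k + 1"] by (simp add: algebra_simps)
    qed
  qed
qed

end

section \<open>The gain from an arc and the opposite arc\<close>

context odd_pizza
begin

text \<open>\<open>E\<close> is the weight of the arc
  \<open>\<beta> + m, ..., \<beta> + m + b\<close>, opposite to that of weight \<open>B\<close>;
  \<open>u\<close> ranges over the half-circles meeting it. The bound is half of
  \<open>B - E - E / 2\<close>: with two jumps, a median of \<open>E\<close> keeps the loss within
  \<open>E / 2\<close>.\<close>

lemma segment_reach:
  fixes \<beta> :: int and b :: nat
  assumes b: "b \<le> m"
    and \<mu>: "\<And>u. \<beta> \<le> u \<Longrightarrow> u \<le> \<beta> + int m + int b \<Longrightarrow> \<mu> \<le> half u"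
  defines "B \<equiv> F (\<beta> + int b) - F \<beta>"
    and "E \<equiv> F (\<beta> + int m + int b + 1) - F (\<beta> + int m)"
  shows "\<exists>s. reach 2 s 0 (\<mu> + (B - E) / 2 - E / 4 - q s)"
proof -
  define \<theta> where "\<theta> = (B - E) / 2 - E / 4"
  have BE: "B - E = L (\<beta> + int b) - G \<beta>"
    by (simp add: B_def E_def L_def G_def algebra_simps)
  have E0: "E \<ge> 0" unfolding E_def using F_mono by simp
  \<comment> \<open>\<open>small\<close>: shifts from a slice of \<open>E\<close> suffice; \<open>one\<close>: start at slice \<open>v\<close> of \<open>B\<close> and jump on
    leaving \<open>B\<close>; \<open>two\<close>: no such \<open>v\<close> is good, so \<open>B\<close> is poor opposite a rich stretch of \<open>E\<close>, and Alice
    starts at the median \<open>w\<close> of \<open>E\<close> and jumps to \<open>B\<close> on leaving that stretch.\<close>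
  consider (small) "B - E \<le> E / 2"
    | (one) v where "\<beta> \<le> v" "v < \<beta> + int b"
        "\<And>x. v < x \<Longrightarrow> x \<le> \<beta> + int b \<Longrightarrow> \<theta> \<le> G x - G \<beta>"
        "\<And>x. \<beta> \<le> x \<Longrightarrow> x \<le> v \<Longrightarrow> \<theta> \<le> L (\<beta> + int b) - L x"
    | (two) "B - E > E / 2"
        "\<And>v. \<beta> \<le> v \<Longrightarrow> v < \<beta> + int b \<Longrightarrow>
          (\<exists>x. v < x \<and> x \<le> \<beta> + int b \<and> G x - G \<beta> < \<theta>) \<or>
          (\<exists>x. \<beta> \<le> x \<and> x \<le> v \<and> L (\<beta> + int b) - L x < \<theta>)"
    by (meson not_le)
  then have "\<exists>s. reach 2 s 0 (\<mu> + \<theta> - q s)"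
  proof cases
    case small
    have "reach 2 (\<beta> + int m) 0 (\<mu> - q (\<beta> + int m))"
    proof (rule reach_by_shifts)
      show "\<mu> - q (\<beta> + int m) \<le> half u - (F (\<beta> + int m + int 0 + 1) - F (\<beta> + int m))"
        if "\<beta> + int m + int 0 - int m \<le> u" "u \<le> \<beta> + int m" for u
        using \<mu>[of u] that F_q[of "\<beta> + int m"] by simp
    qed simp
    then have "reach 2 (\<beta> + int m) 0 (\<mu> + \<theta> - q (\<beta> + int m))"
      by (rule reach_antimono) (use small in \<open>simp add: \<theta>_def\<close>)
    then show ?thesis by blast
  next
    case one
    have "reach (Suc 1) v 0 (\<mu> + \<theta> - (F (v + int 0 + 1) - F v))"
      by (rule reach_one_jump[where \<beta> = \<beta> and \<mu> = \<mu>, OF b \<mu>]) (use one in \<open>auto simp: algebra_simps\<close>)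
    then show ?thesis using F_q[of v] by (auto simp: numeral_2_eq_2)
  next
    case two
    have \<theta>: "\<theta> \<le> B - E" using two(1) E0 by (simp add: \<theta>_def field_simps)
    have "b \<noteq> 0"
    proof
      assume "b = 0"
      then have "B = 0" by (simp add: B_def)
      then show False using two(1) E0 by simp
    qed
    define bad where "bad x \<longleftrightarrow> \<beta> \<le> x \<and> L (\<beta> + int b) - L x < \<theta>" for x
    \<comment> \<open>From the last slice of the arc the left-end bound holds, as
      \<open>G (\<beta> + b) - G \<beta> \<ge> B - E \<ge> \<theta>\<close>; so a right-end bound
      fails, and \<open>\<sigma>\<close> will be the first place where one does.\<close>
    have "\<exists>i. bad (\<beta> + int i) \<and> i < b"
    proof -
      have "\<not> G x - G \<beta> < \<theta>" if "\<beta> + int b - 1 < x" "x \<le> \<beta> + int b" for x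
      proof -
        have "x = \<beta> + int b" using that by simp
        then show ?thesis using BE \<theta> L_G[of x] q_nonneg[of "x + int m"] by simp
      qed
      then obtain x where "\<beta> \<le> x" "x \<le> \<beta> + int b - 1" "L (\<beta> + int b) - L x < \<theta>"
        using two(2)[of "\<beta> + int b - 1"] \<open>b \<noteq> 0\<close> by auto
      then show ?thesis
        by (intro exI[of _ "nat (x - \<beta>)"]) (auto simp: bad_def)
    qed
    define i0 where "i0 = (LEAST i. bad (\<beta> + int i) \<and> i < b)"
    have i0: "bad (\<beta> + int i0)" "i0 < b" and least: "\<And>i. i < i0 \<Longrightarrow> \<not> bad (\<beta> + int i)"
      using LeastI_ex[OF \<open>\<exists>i. bad (\<beta> + int i) \<and> i < b\<close>] not_less_Least[of _ "\<lambda>i. bad (\<beta> + int i) \<and> i < b"]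
      unfolding i0_def[symmetric] by (auto dest: less_trans)
    define \<sigma> where "\<sigma> = \<beta> + int i0"
    have \<sigma>: "\<beta> \<le> \<sigma>" "\<sigma> < \<beta> + int b" "L (\<beta> + int b) - L \<sigma> < \<theta>"
      using i0 by (auto simp: \<sigma>_def bad_def)
    have good: "\<theta> \<le> L (\<beta> + int b) - L x" if "\<beta> \<le> x" "x < \<sigma>" for x
      using least[of "nat (x - \<beta>)"] that by (auto simp: bad_def \<sigma>_def nat_less_iff)
    have "\<beta> \<noteq> \<sigma>"
      using \<sigma>(3) \<theta> BE L_G[of \<beta>] q_nonneg[of "\<beta> + int m"] by auto
    \<comment> \<open>Left of \<open>\<sigma>\<close> all right-end bounds hold, so from
      \<open>\<sigma> - 1\<close> a left-end bound fails; it also fails at \<open>\<tau>\<close>, a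
      minimum of \<open>G\<close> from \<open>\<sigma>\<close> on.\<close>
    obtain x0 where x0: "\<sigma> - 1 < x0" "x0 \<le> \<beta> + int b" "G x0 - G \<beta> < \<theta>"
      using two(2)[of "\<sigma> - 1"] good \<sigma> \<open>\<beta> \<noteq> \<sigma>\<close> by (smt (verit))
    define A where "A = {\<sigma>..\<beta> + int b}"
    have A: "finite (G ` A)" "G ` A \<noteq> {}" using \<sigma> by (auto simp: A_def)
    obtain \<tau> where \<tau>: "\<tau> \<in> A" "G \<tau> = Min (G ` A)"
      using Min_in[OF A] by (metis imageE)
    have \<tau>_min: "G \<tau> \<le> G y" if "y \<in> A" for y
      unfolding \<tau>(2) using A that by simp
    have G\<tau>: "G \<tau> - G \<beta> < \<theta>" using \<tau>_min[of x0] x0 by (simp add: A_def)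
    \<comment> \<open>The two failures add up to less than
      \<open>2 * \<theta> = B - E - E / 2\<close>, while
      \<open>B - E = L (\<beta> + b) - G \<beta>\<close>.\<close>
    have drop: "L \<sigma> - G \<tau> > E / 2"
      using G\<tau> \<sigma>(3) BE unfolding \<theta>_def diff_divide_distrib by linarith
    have "\<tau> \<noteq> \<sigma>" using drop L_G[of \<sigma>] q_nonneg[of "\<sigma> + int m"] E0 by auto
    then have \<sigma>\<tau>: "\<sigma> < \<tau>" "\<tau> \<le> \<beta> + int b" using \<tau>(1) by (auto simp: A_def)
    have L_max: "L y \<le> L \<sigma>" if "\<beta> \<le> y" "y \<le> \<sigma>" for y
      using good[of y] that \<sigma>(3) by (cases "y = \<sigma>") auto
    \<comment> \<open>\<open>w + m\<close> will be the median of \<open>E\<close>: the slices before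
      it and those after it weigh at most \<open>E / 2\<close> each.\<close>
    define heavy where "heavy i \<longleftrightarrow> F (\<beta> + int i + int m + 1) - F (\<beta> + int m) \<ge> E / 2" for i
    have hb: "heavy b" using E0 by (simp add: heavy_def E_def algebra_simps diff_divide_distrib)
    define j where "j = (LEAST i. heavy i)"
    define w where "w = \<beta> + int j"
    have "heavy j" using LeastI[of heavy, OF hb] by (simp add: j_def)
    then have after_w: "F (\<beta> + int m + int b + 1) - F (w + int m + 1) \<le> E / 2"
      unfolding heavy_def w_def E_def diff_divide_distrib by linarith
    have before_w: "F (w + int m) - F (\<beta> + int m) \<le> E / 2"
    proof (cases j)
      case 0
      then show ?thesis using E0 by (simp add: w_def)
    next
      case (Suc i)
      then have "\<not> heavy i" using not_less_Least[of i heavy] by (simp add: j_def)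
      then show ?thesis using Suc by (simp add: heavy_def w_def algebra_simps)
    qed
    \<comment> \<open>The stretch \<open>\<sigma> + m + 1, ..., \<tau> + m - 1\<close> outweighs
      half of \<open>E\<close>, so it contains the median.\<close>
    have region: "F (\<tau> + int m) - F (\<sigma> + int m + 1) > E / 2"
      using drop F_mono[of \<sigma> \<tau>] \<sigma>\<tau> by (simp add: L_def G_def)
    have "\<sigma> < w"
      using region after_w F_mono[of "\<tau> + int m" "\<beta> + int m + int b + 1"]
        F_mono[of "w + int m + 1" "\<sigma> + int m + 1"] \<sigma>\<tau> by (smt (verit))
    have "w < \<tau>"
      using region before_w F_mono[of "\<tau> + int m" "w + int m"]
        F_mono[of "\<beta> + int m" "\<sigma> + int m + 1"] \<sigma> by (smt (verit))
    have \<theta>2: "2 * \<theta> = L (\<beta> + int b) - G \<beta> - E / 2"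
      unfolding \<theta>_def BE by (simp add: field_simps)
    \<comment> \<open>By the choice of \<open>\<sigma>\<close> and \<open>\<tau>\<close>, all four
      bounds reduce to \<open>L a - G c \<le> E / 2\<close> with \<open>a < c\<close>. The left side
      is at most the weight of \<open>a + m + 1, ..., c + m - 1\<close>, a part of \<open>E\<close>
      after the median for \<open>LL\<close> and \<open>LR\<close>, before it for \<open>RL\<close>
      and \<open>RR\<close>.\<close>
    have "reach (Suc (Suc 0)) (w + int m) 0
        (\<mu> + \<theta> - (F (w + int m + int 0 + 1) - F (w + int m)))"
    proof (rule reach_two_jumps[where \<beta> = \<beta> and \<mu> = \<mu> and \<sigma> = \<sigma> and \<tau> = \<tau> and w = w, OF b \<mu>])
      show "\<mu> + \<theta> + L t - L \<sigma> \<le> \<mu> + G y - G \<beta>"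
        if "w \<le> t" "t < \<tau>" "t < y" "y \<le> \<beta> + int b" for t y
        using F_mono[of t y] F_mono[of "y + int m" "\<beta> + int m + int b + 1"]
          F_mono[of "w + int m + 1" "t + int m + 1"] that after_w \<sigma>(3) \<theta>2
        by (simp add: L_def G_def)
      show "\<mu> + \<theta> + L t - L \<sigma> \<le> \<mu> + L (\<beta> + int b) - L y"
        if "w \<le> t" "t < \<tau>" "\<beta> \<le> y" "y \<le> \<sigma>" for t y
        using L_max[of y] F_mono[of t \<tau>] F_mono[of "\<tau> + int m" "\<beta> + int m + int b + 1"]
          F_mono[of "w + int m + 1" "t + int m + 1"] that after_w G\<tau> \<theta>2 \<sigma>\<tau>
        by (simp add: L_def G_def)
      show "\<mu> + \<theta> + G \<tau> - G t \<le> \<mu> + G y - G \<beta>"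
        if "\<sigma> < t" "t \<le> w" "\<tau> \<le> y" "y \<le> \<beta> + int b" for t y
        using \<tau>_min[of y] F_mono[of \<sigma> t] F_mono[of "t + int m" "w + int m"]
          F_mono[of "\<beta> + int m" "\<sigma> + int m + 1"] that before_w \<sigma> \<theta>2 \<sigma>\<tau>
        by (simp add: L_def G_def A_def)
      show "\<mu> + \<theta> + G \<tau> - G t \<le> \<mu> + L (\<beta> + int b) - L y"
        if "\<sigma> < t" "t \<le> w" "\<beta> \<le> y" "y < t" for t y
        using F_mono[of y t] F_mono[of "t + int m" "w + int m"]
          F_mono[of "\<beta> + int m" "y + int m + 1"] that before_w G\<tau> \<theta>2
        by (simp add: L_def G_def)
    qed (use \<sigma> \<sigma>\<tau> \<open>\<sigma> < w\<close> \<open>w < \<tau>\<close> in auto)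
    then show ?thesis using F_q[of "w + int m"] by (auto simp: numeral_2_eq_2)
  qed
  then show ?thesis by (simp add: \<theta>_def algebra_simps)
qed

end

section \<open>Irredundant covers by lightest half-circles\<close>

text \<open>
  Discarding the heaviest member whenever it is redundant leaves witnesses that are covered by
  no lighter set at all, kept or discarded.
\<close>

lemma weighted_irredundant_cover:
  fixes weight :: "'a \<Rightarrow> real" and S :: "'a \<Rightarrow> 'b set"
  assumes "finite I" "V \<subseteq> (\<Union>i\<in>I. S i)"
  shows "\<exists>N\<subseteq>I. V \<subseteq> (\<Union>i\<in>N. S i) \<and>
    (\<forall>i\<in>N. \<exists>v\<in>V. v \<in> S i \<and> (\<forall>j\<in>N - {i}. v \<notin> S j) \<and> (\<forall>j\<in>I. v \<in> S j \<longrightarrow> weight i \<le> weight j))"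
  using assms
proof (induction I arbitrary: V rule: finite_ranking_induct[where f = weight])
  case empty
  then show ?case by simp
next
  case (insert i I)
  show ?case
  proof (cases "V \<subseteq> (\<Union>j\<in>I. S j)")
    case True
    obtain N where N: "N \<subseteq> I" "V \<subseteq> (\<Union>j\<in>N. S j)" and *: "\<forall>k\<in>N. \<exists>v\<in>V. v \<in> S k \<and>
        (\<forall>j\<in>N - {k}. v \<notin> S j) \<and> (\<forall>j\<in>I. v \<in> S j \<longrightarrow> weight k \<le> weight j)"
      using insert.IH[OF True] by blast
    have "\<forall>k\<in>N. weight k \<le> weight i" using N insert.hyps by auto
    then show ?thesis using N * by (intro exI[of _ N]) (simp, blast)
  next
    case False
    then obtain v where v: "v \<in> V" "v \<notin> (\<Union>j\<in>I. S j)" by blast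
    \<comment> \<open>Applying the induction hypothesis to \<open>V - S i\<close> keeps the other
      witnesses out of \<open>S i\<close>.\<close>
    have "V - S i \<subseteq> (\<Union>j\<in>I. S j)" using insert.prems by auto
    from insert.IH[OF this] obtain N where N: "N \<subseteq> I" "V - S i \<subseteq> (\<Union>j\<in>N. S j)"
      and *: "\<And>k. k \<in> N \<Longrightarrow> \<exists>v\<in>V - S i. v \<in> S k \<and>
        (\<forall>j\<in>N - {k}. v \<notin> S j) \<and> (\<forall>j\<in>I. v \<in> S j \<longrightarrow> weight k \<le> weight j)"
      by blast
    have "v \<in> S i" using v insert.prems by auto
    have "\<exists>v\<in>V. v \<in> S k \<and> (\<forall>j\<in>insert i N - {k}. v \<notin> S j) \<and>
        (\<forall>j\<in>insert i I. v \<in> S j \<longrightarrow> weight k \<le> weight j)" if "k \<in> insert i N" for k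
    proof (cases "k = i")
      case True
      then show ?thesis using v \<open>v \<in> S i\<close> N by (intro bexI[of _ v]) auto
    next
      case False
      then have "k \<in> N" using that by simp
      then obtain x where "x \<in> V - S i" "x \<in> S k" "\<forall>j\<in>N - {k}. x \<notin> S j"
        "\<forall>j\<in>I. x \<in> S j \<longrightarrow> weight k \<le> weight j"
        using *[of k] by blast
      then show ?thesis by (intro bexI[of _ x]) auto
    qed
    then show ?thesis using N by (intro exI[of _ "insert i N"]) auto
  qed
qed

context odd_pizza
begin

lemma reach_window:
  assumes "\<And>y. y \<le> v \<Longrightarrow> v \<le> y + int m \<Longrightarrow> half u \<le> half y"
  shows "reach J v 0 (half u - q v)"
proof (rule reach_by_shifts)
  show "half u - q v \<le> half y - (F (v + int 0 + 1) - F v)"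
    if "v + int 0 - int m \<le> y" "y \<le> v" for y
    using assms[of y] that F_q[of v] by simp
qed simp

text \<open>\<open>v\<close> and \<open>v'\<close> lie before and after the overlap
  \<open>u', ..., u + m\<close>, at distance at most \<open>m + 1\<close>, so every half-circle
  meeting the overlap contains one of them. Now \<open>segment_reach\<close> applies with the
  overlap as \<open>E\<close> and the \<open>b\<close> slices outside both half-circles as
  \<open>B\<close>.\<close>

lemma reach_overlap:
  assumes u: "u' \<le> u + int m"
    and v: "v < u'" "u + int m < v'" "v' \<le> v + int m + 1"
    and min: "\<And>y. y \<le> v \<Longrightarrow> v \<le> y + int m \<Longrightarrow> half u \<le> half y"
    and min': "\<And>y. y \<le> v' \<Longrightarrow> v' \<le> y + int m \<Longrightarrow> half u' \<le> half y"
  shows "\<exists>s. reach 2 s 0 (min (half u) (half u') + (whole - half u - half u') / 2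
    - (F (u + int m + 1) - F u') / 4 - q s)"
proof -
  define b where "b = nat (int m + u - u')"
  have b: "int b = int m + u - u'" using u by (simp add: b_def)
  have "b \<le> m" using b v by linarith
  have end_eqs: "u' - int m + int b = u" "u' + int b = u + int m" using b by auto
  have "min (half u) (half u') \<le> half y" if "u' - int m \<le> y" "y \<le> u + int m" for y
  proof (cases "y \<le> v")
    case True
    then show ?thesis using min[of y] that v by auto
  next
    case False
    then show ?thesis using min'[of y] that v by auto
  qed
  then have "\<exists>s. reach 2 s 0 (min (half u) (half u')
      + ((F u - F (u' - int m)) - (F (u + int m + 1) - F u')) / 2 - (F (u + int m + 1) - F u') / 4 - q s)"
    using segment_reach[of b "u' - int m" "min (half u) (half u')", OF \<open>b \<le> m\<close>]
    unfolding diff_add_cancel end_eqs by blast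
  moreover have "F u - F (u' - int m) - (F (u + int m + 1) - F u') = whole - half u - half u'"
    using F_periodic[of "u' - int m"] by (simp add: half_def algebra_simps)
  ultimately show ?thesis by simp
qed

lemma reach_three_windows:
  assumes u: "u1 < u2" "u2 < u3" "u3 < u1 + int n"
    and v1: "u3 + int m - int n < v1" "u1 \<le> v1" "v1 \<le> u1 + int m" "v1 < u2"
    and v2: "u1 + int m < v2" "u2 \<le> v2" "v2 \<le> u2 + int m" "v2 < u3"
    and v3: "u2 + int m < v3" "u3 \<le> v3" "v3 \<le> u3 + int m" "v3 < u1 + int n"
    and min1: "\<And>y. y \<le> v1 \<Longrightarrow> v1 \<le> y + int m \<Longrightarrow> half u1 \<le> half y"
    and min2: "\<And>y. y \<le> v2 \<Longrightarrow> v2 \<le> y + int m \<Longrightarrow> half u2 \<le> half y"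
    and min3: "\<And>y. y \<le> v3 \<Longrightarrow> v3 \<le> y + int m \<Longrightarrow> half u3 \<le> half y"
  shows "\<exists>s. reach 2 s 0 (4 * whole / 9 - q s)"
proof (rule ccontr)
  assume none: "\<nexists>s. reach 2 s 0 (4 * whole / 9 - q s)"
  have bound: "g < 4 * whole / 9" if "\<exists>s. reach 2 s 0 (g - q s)" for g
  proof (rule ccontr)
    assume "\<not> g < 4 * whole / 9"
    then show False using that none reach_antimono by (meson diff_right_mono not_less)
  qed
  define h1 h2 h3 where "h1 = half u1" and "h2 = half u2" and "h3 = half u3"
  define c e a where "c = F (u1 + int m + 1) - F u2" and "e = F (u2 + int m + 1) - F u3"
    and "a = F (u3 + int m + 1) - F (u1 + int n)"
  have "h1 < 4 * whole / 9" "h2 < 4 * whole / 9" "h3 < 4 * whole / 9"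
    using reach_window[of v1 u1 2, OF min1] reach_window[of v2 u2 2, OF min2]
      reach_window[of v3 u3 2, OF min3] bound unfolding h1_def h2_def h3_def by blast+
  moreover have "min h1 h2 + (whole - h1 - h2) / 2 - c / 4 < 4 * whole / 9"
    unfolding h1_def h2_def c_def
    by (rule bound, rule reach_overlap[where v = v1 and v' = v2]) (use v1 v2 v3 min1 min2 in auto)
  moreover have "min h2 h3 + (whole - h2 - h3) / 2 - e / 4 < 4 * whole / 9"
    unfolding h2_def h3_def e_def
    by (rule bound, rule reach_overlap[where v = v2 and v' = v3]) (use v1 v2 v3 min2 min3 in auto)
  moreover have "min h3 h1 + (whole - h3 - h1) / 2 - a / 4 < 4 * whole / 9"
  proof -
    \<comment> \<open>The third pair wraps around: after \<open>u3\<close> comes the copy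
      \<open>u1 + int n\<close> of the first half-circle.\<close>
    have min1': "half (u1 + int n) \<le> half y" if "y \<le> v1 + int n" "v1 + int n \<le> y + int m" for y
      using min1[of "y - int n"] that half_periodic[of u1] half_periodic[of "y - int n"] by simp
    have "min h3 (half (u1 + int n)) + (whole - h3 - half (u1 + int n)) / 2 - a / 4 < 4 * whole / 9"
      unfolding h3_def a_def
      by (rule bound, rule reach_overlap[where v = v3 and v' = "v1 + int n"])
        (use v1 v2 v3 min1' min3 in auto)
    then show ?thesis unfolding h1_def half_periodic .
  qed
  moreover have "a + c + e = h1 + h2 + h3 - whole"
    using F_periodic[of u1] by (simp add: a_def c_def e_def h1_def h2_def h3_def half_def)
  moreover have "c \<ge> 0" "e \<ge> 0" "a \<ge> 0"
    using v1 v2 v3 by (auto simp: c_def e_def a_def intro!: F_mono)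
  \<comment> \<open>Let \<open>x \<ge> y \<ge> z\<close> be the three weights and \<open>W\<close>
    the whole. As \<open>x < 4 * W / 9\<close> and overlaps are nonnegative, the bound for
    \<open>x, y\<close> forces \<open>y - z < W / 9\<close>; adding the bound for
    \<open>y, z\<close> forces \<open>y - z > W / 9\<close>.\<close>
  ultimately show False
    unfolding diff_divide_distrib by linarith
qed

lemma half_periodic_mult: "half (u + c * int n) = half u"
proof (induction c rule: int_induct[where k = 0])
  case (step1 c)
  then show ?case using half_periodic[of "u + c * int n"] by (simp add: algebra_simps)
next
  case (step2 c)
  then show ?case using half_periodic[of "u + (c - 1) * int n"] by (simp add: algebra_simps)
qed simp

lemma half_mod: "half (u mod int n) = half u"
  using half_periodic_mult[of "u mod int n" "u div int n"]
  unfolding mod_div_mult_eq ..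

lemma reach_four_ninths: "\<exists>s. reach 2 s 0 (4 * whole / 9 - q s)"
proof (cases "m = 0")
  case True
  have "4 * whole / 9 - q 0 \<le> 0"
    unfolding whole_def using True F_q[of 0] q_nonneg[of 0] by simp
  then have "reach 2 0 m (4 * whole / 9 - q 0)" by (rule reach_final)
  then show ?thesis using True by auto
next
  case False
  define I where "I = {0..<int n}"
  define S where "S u = {i \<in> I. (i - u) mod int n \<le> int m}" for u
  have "\<And>i. i \<in> I \<Longrightarrow> i \<in> S i" by (simp add: S_def)
  then have "I \<subseteq> (\<Union>i\<in>I. S i)" by blast
  moreover have "finite I" by (simp add: I_def)
  ultimately obtain N where N: "N \<subseteq> I" "I \<subseteq> (\<Union>i\<in>N. S i)"
    and excl: "\<And>u. u \<in> N \<Longrightarrow> \<exists>v\<in>I. v \<in> S u \<and> (\<forall>j\<in>N - {u}. v \<notin> S j) \<and>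
      (\<forall>j\<in>I. v \<in> S j \<longrightarrow> half u \<le> half j)"
    using weighted_irredundant_cover[of I I S half] by blast
  have cover: "\<exists>u\<in>N. (i - u) mod int n \<le> int m" for i
  proof -
    have "i mod int n \<in> I" by (simp add: I_def)
    then obtain u where "u \<in> N" "(i mod int n - u) mod int n \<le> int m"
      using N(2) unfolding S_def by blast
    then show ?thesis unfolding mod_diff_left_eq by blast
  qed
  have mod_window: "(i - u) mod int n = i - u - c * int n"
    if "u + c * int n \<le> i" "i \<le> u + c * int n + int m" for i u c
  proof -
    have "(i - u) mod int n = (i - u - c * int n) mod int n"
      using mod_mult_self1[of "i - u - c * int n" c "int n"] by (simp only: diff_add_cancel)
    also have "\<dots> = i - u - c * int n" using that by (intro mod_pos_pos_trivial) auto
    finally show ?thesis .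
  qed
  \<comment> \<open>Witnesses are lifted to integers in \<open>u, ..., u + m\<close>; the multiples
    \<open>c * int n\<close> run through all copies of the other half-circles.\<close>
  define witness where "witness u v \<longleftrightarrow> u \<le> v \<and> v \<le> u + int m \<and>
      (\<forall>u'\<in>N - {u}. \<forall>c. \<not> (u' + c * int n \<le> v \<and> v \<le> u' + c * int n + int m)) \<and>
      (\<forall>y. y \<le> v \<longrightarrow> v \<le> y + int m \<longrightarrow> half u \<le> half y)" for u v
  have "\<exists>v. witness u v" if "u \<in> N" for u
  proof -
    obtain x where x: "x \<in> I" "x \<in> S u" "\<And>j. j \<in> N - {u} \<Longrightarrow> x \<notin> S j"
      "\<And>j. j \<in> I \<Longrightarrow> x \<in> S j \<Longrightarrow> half u \<le> half j"
      using excl[OF \<open>u \<in> N\<close>] by blast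
    define v where "v = u + (x - u) mod int n"
    have v: "(v - j) mod int n = (x - j) mod int n" for j
      using mod_add_right_eq[of "u - j" "x - u" "int n"] by (simp add: v_def algebra_simps)
    have "u \<le> v" "v \<le> u + int m" using x(2) by (auto simp: v_def S_def)
    moreover have False if "u' \<in> N - {u}" "u' + c * int n \<le> v" "v \<le> u' + c * int n + int m" for u' c
      using x(3)[OF that(1)] x(1) mod_window[OF that(2,3)] that v[of u'] by (auto simp: S_def)
    moreover have "half u \<le> half y" if "y \<le> v" "v \<le> y + int m" for y
    proof -
      have "(x - y mod int n) mod int n = v - y"
        using mod_window[of y 0 v] that v[of y] by (simp add: mod_diff_right_eq)
      then have "x \<in> S (y mod int n)" using x(1) that by (simp add: S_def)
      moreover have "y mod int n \<in> I" by (simp add: I_def)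
      ultimately show ?thesis using x(4) half_mod by metis
    qed
    ultimately show ?thesis unfolding witness_def by blast
  qed
  then obtain v where "\<forall>u\<in>N. witness u (v u)" using bchoice[of N witness] by blast
  then have v: "\<And>u. u \<in> N \<Longrightarrow> u \<le> v u" "\<And>u. u \<in> N \<Longrightarrow> v u \<le> u + int m"
    and sep: "\<And>u u' c. u \<in> N \<Longrightarrow> u' \<in> N \<Longrightarrow> u' \<noteq> u \<Longrightarrow>
      \<not> (u' + c * int n \<le> v u \<and> v u \<le> u' + c * int n + int m)"
    and min: "\<And>u y. u \<in> N \<Longrightarrow> y \<le> v u \<Longrightarrow> v u \<le> y + int m \<Longrightarrow> half u \<le> half y"
    unfolding witness_def by blast+
  have range: "0 \<le> u" "u < int n" if "u \<in> N" for u using that N(1) by (auto simp: I_def)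
  have between: "v u < u'" "u + int m < v u'" "v u' < u + int n" "u' + int m - int n < v u"
    if "u \<in> N" "u' \<in> N" "u < u'" for u u'
    using sep[of u u' 0] sep[of u' u 0] sep[of u u' "-1"] sep[of u' u 1] v[of u] v[of u']
      range[of u] range[of u'] that by auto
  have "finite N" using N(1) finite_subset by (auto simp: I_def)
  define us where "us = sorted_list_of_set N"
  have us: "set us = N" "sorted_wrt (<) us"
    using \<open>finite N\<close> by (simp_all add: us_def)
  consider "us = []" | u where "us = [u]" | u1 u2 where "us = [u1, u2]"
    | u1 u2 u3 where "us = [u1, u2, u3]" | u1 u2 u3 u4 r where "us = u1 # u2 # u3 # u4 # r"
    by (metis list.exhaust)
  then show ?thesis
  proof cases
    case 1
    then show ?thesis using us cover[of 0] by auto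
  next
    case (2 u)
    then have "(u - 1 - u) mod int n \<le> int m" using us cover[of "u - 1"] by auto
    moreover have "(u - 1 - u) mod int n = 2 * int m"
      by (simp add: zmod_minus1)
    ultimately show ?thesis using False by simp
  next
    case (3 u1 u2)
    then have N2: "N = {u1, u2}" "u1 < u2" using us by auto
    then have r: "0 \<le> u1" "u2 < int n" using range by auto
    have wrap: "(u - 1 - u) mod int n = 2 * int m" for u :: int
      by (simp add: zmod_minus1)
    have "(u2 - 1 - u1) mod int n \<le> int m"
      using cover[of "u2 - 1"] wrap[of u2] False N2 by auto
    then have "u2 \<le> u1 + int m + 1" using r N2 by (simp add: mod_pos_pos_trivial)
    moreover have "(u1 - 1 - u2) mod int n \<le> int m"
      using cover[of "u1 - 1"] wrap[of u1] False N2 by auto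
    then have "(u1 - 1 - u2 + int n) mod int n \<le> int m" by (simp only: mod_add_self2)
    then have "u1 + int n \<le> u2 + int m + 1" using r N2 by (subst (asm) mod_pos_pos_trivial) auto
    ultimately have "whole \<le> half u1 + half u2"
      using F_mono[of u2 "u1 + int m + 1"] F_mono[of "u1 + int n" "u2 + int m + 1"] F_periodic[of u1]
      by (simp add: half_def)
    moreover have "whole \<ge> 0" using F_mono[of 0 "int n"] by (simp add: whole_def)
    ultimately have "4 * whole / 9 \<le> half u1 \<or> 4 * whole / 9 \<le> half u2" by linarith
    then obtain u where "u \<in> N" "4 * whole / 9 \<le> half u" using N2 by auto
    then show ?thesis
      using reach_window[of "v u" u 2, OF min] reach_antimono by (meson diff_right_mono)
  next
    case (4 u1 u2 u3)
    then have N3: "u1 \<in> N" "u2 \<in> N" "u3 \<in> N" "u1 < u2" "u2 < u3" using us by auto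
    show ?thesis
      by (rule reach_three_windows[of u1 u2 u3 "v u1" "v u2" "v u3"])
        (use N3 v between[of u1 u2] between[of u2 u3] between[of u1 u3] range min in auto)
  next
    \<comment> \<open>Here \<open>v u3\<close> separates the half-circle at \<open>u2\<close> from
      the one at \<open>u4\<close>, and \<open>v u1\<close> separates them on the other side:
      \<open>2 * m + 2\<close> distinct slices among \<open>2 * m + 1\<close>.\<close>
    case (5 u1 u2 u3 u4 r)
    then have "u1 \<in> N" "u2 \<in> N" "u3 \<in> N" "u4 \<in> N" "u1 < u2" "u2 < u3" "u3 < u4" using us by auto
    then show ?thesis
      using between[of u1 u2] between[of u1 u4] between[of u2 u3] between[of u3 u4] by simp
  qed
qed

end

section \<open>Even pizzas\<close>

text \<open>The remaining arc has odd length, so whichever end Bob takes, a shift gives Alice the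
  first or the last of \<open>l - 2, l - 4, ..., l - d + 1\<close>, the remaining slices of her
  colour class.\<close>

lemma guarantees_by_shifts_even:
  assumes "\<And>i. P (i + int n) = P i" "even n" "odd d" "Suc d \<le> n"
    and "g \<le> (\<Sum>i<d div 2. P (l - 2 - 2 * int i))"
  shows "guarantees P n d J l g"
  using assms(3-)
proof (induction d arbitrary: l g rule: induct_nat_012)
  case (ge2 d)
  have split: "(\<Sum>i<Suc (Suc d) div 2. P (x - 2 * int i))
      = P x + (\<Sum>i<d div 2. P (x - 2 - 2 * int i))" for x
    by (simp add: sum.lessThan_Suc_shift algebra_simps del: sum.lessThan_Suc)
  have split': "(\<Sum>i<Suc (Suc d) div 2. P (x - 2 * int i))
      = (\<Sum>i<d div 2. P (x - 2 * int i)) + P (x - int d + 1)" for x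
    using ge2.prems(1) by (auto elim!: oddE)
  have "guarantees P n d J (l - 2) (g - P (l - 2))"
    by (rule ge2.IH(1)) (use ge2.prems split[of "l - 2"] in auto)
  moreover have "P (l + int n - int d - 1) = P (l - 2 - int d + 1)"
    using assms(1)[of "l - int d - 1"] by (simp add: algebra_simps)
  then have "guarantees P n d J l (g - P (l + int n - int d - 1))"
    by (intro ge2.IH(1)) (use ge2.prems split'[of "l - 2"] in auto)
  ultimately show ?case by simp
qed simp_all

lemma slice_periodic: "slice n (i + int n) = slice n i"
  by (simp add: slice_def)

lemma even_pizza_strategy:
  assumes "pizza n p" "even n"
  shows "\<exists>\<sigma>. jump_strategy n 2 \<sigma> \<and> has_gain n p \<sigma> (pizza_size n p / 2)"
proof -
  obtain k where k: "n = 2 * k" "k > 0" using assms by (auto simp: pizza_def elim!: evenE)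
  define P where "P i = p (slice n i)" for i
  have per: "P (i + int n) = P i" for i by (simp add: P_def slice_periodic)
  define Q where "Q l = (\<Sum>i<k. P (l - 2 * int i))" for l
  have "Q (int n - 1) + Q (int n - 2) = pizza_size n p"
  proof -
    have "(\<Sum>i<j. p (2 * i + 1)) + (\<Sum>i<j. p (2 * i)) = (\<Sum>i<2 * j. p i)" for j
      by (induction j) auto
    moreover have "Q (int n - 1) = (\<Sum>i<k. p (2 * i + 1))"
      unfolding Q_def
    proof (subst sum.nat_diff_reindex[symmetric], intro sum.cong refl)
      fix i assume "i \<in> {..<k}"
      then have "int n - 1 - 2 * int (k - Suc i) = int (2 * i + 1)" "2 * i + 1 < n" using k by auto
      then show "P (int n - 1 - 2 * int (k - Suc i)) = p (2 * i + 1)"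
        unfolding P_def by (simp only: slice_of_nat)
    qed
    moreover have "Q (int n - 2) = (\<Sum>i<k. p (2 * i))"
      unfolding Q_def
    proof (subst sum.nat_diff_reindex[symmetric], intro sum.cong refl)
      fix i assume "i \<in> {..<k}"
      then have "int n - 2 - 2 * int (k - Suc i) = int (2 * i)" "2 * i < n" using k by auto
      then show "P (int n - 2 - 2 * int (k - Suc i)) = p (2 * i)"
        unfolding P_def by (simp only: slice_of_nat)
    qed
    ultimately show ?thesis by (simp add: pizza_size_def k)
  qed
  then obtain l where l: "pizza_size n p / 2 \<le> Q l"
    by (metis add_mono field_sum_of_halves linorder_not_le add_strict_mono less_irrefl)
  have "guarantees P n (n - 1) 2 l (pizza_size n p / 2 - P l)"
  proof (rule guarantees_by_shifts_even[of P n, OF per])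
    obtain j where j: "k = Suc j" using k gr0_implies_Suc by blast
    have "Q l = P l + (\<Sum>i<j. P (l - 2 - 2 * int i))"
      unfolding Q_def j by (simp add: sum.lessThan_Suc_shift algebra_simps del: sum.lessThan_Suc)
    then show "pizza_size n p / 2 - P l \<le> (\<Sum>i<(n - 1) div 2. P (l - 2 - 2 * int i))"
      using l k j by simp
  qed (use k in auto)
  then show ?thesis
    using strategy_of_guarantees[of n p 2 l] k unfolding P_def by simp
qed

section \<open>The bound for odd pizzas, and the theorem\<close>

definition cumulative :: "(int \<Rightarrow> real) \<Rightarrow> int \<Rightarrow> real" where
  "cumulative f i = (if i \<ge> 0 then sum f {0..<i} else - sum f {i..<0})"

lemma cumulative_step: "cumulative f (i + 1) = cumulative f i + f i"
proof -
  have "{0..<i + 1} = insert i {0..<i}" if "i \<ge> 0" using that by auto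
  moreover have "{i..<0} = insert i {i + 1..<0}" if "i < 0" using that by auto
  ultimately show ?thesis by (auto simp: cumulative_def)
qed

lemma odd_pizza_strategy:
  assumes "pizza n p" "odd n"
  shows "\<exists>\<sigma>. jump_strategy n 2 \<sigma> \<and> has_gain n p \<sigma> (4 * pizza_size n p / 9)"
proof -
  obtain m where n: "n = 2 * m + 1" using assms(2) by (auto elim!: oddE)
  define P where "P i = p (slice n i)" for i
  define F where "F = cumulative (\<lambda>i. P (2 * i))"
  interpret odd_pizza P m F
  proof
    show "P i \<ge> 0" for i
      using assms slice_less[of n i] by (simp add: P_def pizza_def)
    show "P (i + (2 * int m + 1)) = P i" for i
      using slice_periodic[of n i] by (simp add: P_def n algebra_simps)
    show "F (i + 1) = F i + P (2 * i)" for i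
      by (simp add: F_def cumulative_step)
  qed
  have "whole = (\<Sum>i\<in>{0..<int n}. P (2 * i))"
    unfolding whole_def unfolding F_def cumulative_def n by simp
  also have "\<dots> = (\<Sum>i<n. p i)"
    unfolding P_def
  proof (rule sum.reindex_bij_betw)
    \<comment> \<open>Doubling permutes the residues modulo an odd \<open>n\<close>, so steps of two
      visit each slice once.\<close>
    have "inj_on (\<lambda>i. slice n (2 * i)) {0..<int n}"
    proof (rule inj_onI)
      fix i j assume ij: "i \<in> {0..<int n}" "j \<in> {0..<int n}" "slice n (2 * i) = slice n (2 * j)"
      then have "int n dvd 2 * (i - j)"
        by (simp add: slice_eq_iff n mod_eq_dvd_iff algebra_simps)
      then have "int n dvd i - j"
        by (rule coprime_dvd_mult_right_iff[THEN iffD1, rotated]) (simp add: n)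
      moreover have "\<bar>i - j\<bar> < int n" using ij by auto
      ultimately show "i = j" using dvd_imp_le_int[of "i - j" "int n"] by auto
    qed
    moreover have "(\<lambda>i. slice n (2 * i)) ` {0..<int n} \<subseteq> {..<n}"
      using n by (auto simp: slice_less)
    ultimately show "bij_betw (\<lambda>i. slice n (2 * i)) {0..<int n} {..<n}"
      unfolding bij_betw_def by (intro conjI card_subset_eq) (simp_all add: card_image)
  qed
  finally have size: "whole = pizza_size n p" by (simp add: pizza_size_def)
  obtain s where "reach 2 s 0 (4 * whole / 9 - q s)" using reach_four_ninths by blast
  then have "guarantees (\<lambda>i. p (slice n i)) n (n - 1) 2 (2 * s)
      (4 * pizza_size n p / 9 - p (slice n (2 * s)))"
    unfolding reach_def size q_def by (simp add: P_def[abs_def] n)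
  then show ?thesis using strategy_of_guarantees[of n p 2 "2 * s"] n by simp
qed

theorem theorem1:
  fixes n :: nat and p :: "nat \<Rightarrow> real"
  assumes "pizza n p"
  shows "\<exists>\<sigma>. jump_strategy n 2 \<sigma> \<and> has_gain n p \<sigma> (4 * pizza_size n p / 9)"
proof (cases "even n")
  case True
  have "pizza_size n p \<ge> 0"
    using assms by (auto simp: pizza_def pizza_size_def intro!: sum_nonneg)
  then have "4 * pizza_size n p / 9 \<le> pizza_size n p / 2" by simp
  then show ?thesis
    using even_pizza_strategy[OF assms True] unfolding has_gain_def by (meson order_trans)
next
  case False
  then show ?thesis using odd_pizza_strategy[OF assms] by simp
qed

end
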